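(* Let $P>0$, $N\in\mathbb{N}$, $\alpha\in(0,1)$ and $\rho\in[0,1]$ be fixed, and let $E(\rho)$ be the random coding error exponent of the time-correlated fading channel with initial fading gain $u_0$ known (defined in the context). Then, as $u_0\to\infty$, $$E(\rho)=\frac1N\sum_{i=1}^{N}\rho\log\left(1+\frac{P u_0^2\alpha^{2i}}{1+\rho}\right)+O\left(\frac{1}{\sqrt{u_0}}\right)-O\left(e^{-u_0^2}\right).$$
   Context: Conditioned on the initial gain $u_0>0$, the fading gains $u_1,\dots,u_N\ge 0$ over a codeword of length $N$ form a Markov chain with joint density $f(u_1,\dots,u_N\mid u_0)=\prod_{i=1}^N q(u_i\mid u_{i-1})$, where for $u\ge0$ $$q(u\mid v)=\frac{2u}{1-\alpha^2}\exp\left(-\frac{u^2+\alpha^2v^2}{1-\alpha^2}\right)\mathcal{I}_0\left(\frac{2\alpha uv}{1-\alpha^2}\right),$$ $q(u\mid v)=0$ for $u<0$, and $\mathcal I_0$ is the modified Bessel function of the first kind of order zero. Here $\alpha$ is the channel correlation coefficient and $P$ is the transmit power (noise has unit variance). The random coding error exponent (with i.i.d. Gaussian inputs) given $u_0$ is $$E(\rho)=-\frac1N\log\mathbb{E}\left\{\prod_{i=1}^N\left(\frac{1}{1+\frac{P}{1+\rho}u_i^2}\right)^{\rho}\ \Big|\ u_0\right\}.$$ $\log$ is the natural logarithm. $O(\cdot)$ terms are functions of $u_0$ as $u_0\to\infty$: $f=O(g)$ means $|f/g|$ stays bounded. *)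

theory Defs
  imports "HOL-Analysis.Analysis" "HOL-Library.Landau_Symbols"
begin

text \<open>Modified Bessel function of the first kind of order zero (power series, real argument).\<close>

definition bessel_I0 :: "real \<Rightarrow> real" where
  "bessel_I0 z = (\<Sum>k. (z / 2) ^ (2 * k) / (fact k)\<^sup>2)"

text \<open>Argument order: the new gain \<open>u\<close>, then the previous gain \<open>v\<close> it is conditioned on.\<close>

definition fading_kernel :: "real \<Rightarrow> real \<Rightarrow> real \<Rightarrow> real" where
  "fading_kernel \<alpha> u v =
     (if u \<ge> 0 then
        2 * u / (1 - \<alpha>\<^sup>2) * exp (- (u\<^sup>2 + \<alpha>\<^sup>2 * v\<^sup>2) / (1 - \<alpha>\<^sup>2))
          * bessel_I0 (2 * \<alpha> * u * v / (1 - \<alpha>\<^sup>2))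
      else 0)"

text \<open>Gain vectors \<open>(u\<^sub>1, \<dots>, u\<^sub>N)\<close> are functions with domain \<open>{1..N}\<close>; the value that
  \<open>u\<close> takes at 0 is never used, the predecessor of \<open>u\<^sub>1\<close> being the parameter \<open>u0\<close>.\<close>

definition fading_density :: "real \<Rightarrow> nat \<Rightarrow> real \<Rightarrow> (nat \<Rightarrow> real) \<Rightarrow> real" where
  "fading_density \<alpha> N u0 u =
     (\<Prod>i\<in>{1..N}. fading_kernel \<alpha> (u i) (if i = 1 then u0 else u (i - 1)))"

definition fading_law :: "real \<Rightarrow> nat \<Rightarrow> real \<Rightarrow> (nat \<Rightarrow> real) measure" where
  "fading_law \<alpha> N u0 =
     density (Pi\<^sub>M {1..N} (\<lambda>_. lborel)) (\<lambda>u. ennreal (fading_density \<alpha> N u0 u))"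

text \<open>Conditional expectation given \<open>u0\<close> is integration against \<open>fading_law\<close>.\<close>

definition error_exponent :: "real \<Rightarrow> nat \<Rightarrow> real \<Rightarrow> real \<Rightarrow> real \<Rightarrow> real" where
  "error_exponent P N \<alpha> \<rho> u0 =
     - (1 / real N) *
       ln (LINT u|fading_law \<alpha> N u0.
             (\<Prod>i\<in>{1..N}. (1 / (1 + P / (1 + \<rho>) * (u i)\<^sup>2)) powr \<rho>))"

end

theory Submission
  imports Defs "HOL-Probability.Distributions"
begin

text \<open>
  The remainder is put entirely into the \<open>O(1/sqrt u0)\<close> term, with \<open>h = 0\<close>. Integrating the chain
  one gain at a time, the expectation is the \<open>N\<close>-th iterate, applied to the constant 1, of
  \<open>f \<mapsto> (\<lambda>v. \<integral> q(u|v) w(u) f(u) du)\<close> with \<open>w(u) = (1 + P u\<^sup>2 / (1 + \<rho>)) powr (-\<rho>)\<close>.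
  Since \<open>\<I>\<^sub>0 z \<le> exp z\<close>, the kernel is dominated by a Gaussian centred at \<open>\<alpha> v\<close>, so
  all but an exponentially small part of its mass lies within \<open>sqrt v\<close> of \<open>\<alpha> v\<close>. There a
  function \<open>H\<close> with at most polynomial decay varies only by a factor \<open>exp (O(1/sqrt v))\<close>; hence averaging
  \<open>H\<close> amounts to evaluating it at \<open>\<alpha> v\<close> up to such a factor, and induction on \<open>N\<close> gives
  \<open>\<Prod>i. w(\<alpha>\<^sup>i v)\<close>.
\<close>

section \<open>The Bessel series and its exponential bound\<close>

lemma summable_bessel_I0: "summable (\<lambda>k. (z / 2) ^ (2 * k) / (fact k)\<^sup>2 :: real)"
proof (rule summable_comparison_test')
  show "summable (\<lambda>k. inverse (fact k) * ((z / 2)\<^sup>2) ^ k)"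
    by (rule summable_exp)
  fix k :: nat
  have "(1::real) \<le> fact k" by (rule fact_ge_1)
  then show "norm ((z / 2) ^ (2 * k) / (fact k)\<^sup>2) \<le> inverse (fact k) * ((z / 2)\<^sup>2) ^ k"
    by (simp add: power_mult power2_eq_square divide_simps mult_le_cancel_left1)
qed

lemma bessel_I0_nonneg: "bessel_I0 z \<ge> 0"
  unfolding bessel_I0_def by (intro suminf_nonneg summable_bessel_I0) simp

lemma bessel_I0_measurable [measurable]: "bessel_I0 \<in> borel_measurable borel"
  unfolding bessel_I0_def[abs_def] by measurable

text \<open>The central binomial coefficient is at most \<open>4 ^ k\<close>. This is the
  coefficient comparison between the Bessel series and the \<open>cosh\<close> series.\<close>

lemma fact_double_le: "fact (2 * k) \<le> (4 ^ k * (fact k)\<^sup>2 :: real)"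
proof (induction k)
  case (Suc k)
  have "fact (2 * Suc k) = (2 * real k + 2) * (2 * real k + 1) * fact (2 * k)"
    by (simp add: algebra_simps)
  also have "\<dots> \<le> (2 * real k + 2) * (2 * real k + 2) * (4 ^ k * (fact k)\<^sup>2)"
    by (intro mult_mono Suc) auto
  also have "\<dots> = 4 ^ Suc k * (fact (Suc k))\<^sup>2"
    by (simp add: power2_eq_square algebra_simps)
  finally show ?case .
qed simp

text \<open>Termwise comparison with the even series of \<open>cosh\<close>, which is at most
  \<open>exp\<close> on the nonnegative half-line.\<close>

lemma bessel_I0_le_exp:
  assumes "z \<ge> 0"
  shows "bessel_I0 z \<le> exp z"
proof -
  have s: "(\<lambda>n. if even n then z ^ n /\<^sub>R fact n else 0) sums cosh z"
    by (rule cosh_converges)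
  \<comment> \<open>Reindexing by \<open>2 * k\<close> discards exactly the vanishing odd
    terms.\<close>
  have "(\<lambda>k. (\<lambda>n. if even n then z ^ n /\<^sub>R fact n else 0) (2 * k)) sums cosh z"
  proof (subst sums_mono_reindex)
    show "(if even n then z ^ n /\<^sub>R fact n else 0) = 0" if "n \<notin> range (\<lambda>k. 2 * k)" for n :: nat
    proof -
      have "odd n" using that by (auto simp: dvd_def)
      then show ?thesis by simp
    qed
  qed (use s in \<open>auto simp: strict_mono_def\<close>)
  then have "(\<lambda>k. z ^ (2 * k) / fact (2 * k)) sums cosh z"
    by (simp add: field_simps)
  moreover have "(z / 2) ^ (2 * k) / (fact k)\<^sup>2 \<le> z ^ (2 * k) / fact (2 * k)" for k
    using fact_double_le[of k] assms
    by (simp add: power_divide power_mult divide_simps mult_left_mono)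
  ultimately have "bessel_I0 z \<le> cosh z"
    unfolding bessel_I0_def by (intro sums_le[OF _ summable_sums[OF summable_bessel_I0]])
  also have "\<dots> \<le> exp z"
    using assms by (simp add: cosh_def)
  finally show ?thesis .
qed

section \<open>The fading kernel as a probability density\<close>

lemma fading_kernel_measurable [measurable (raw)]:
  assumes [measurable]: "f \<in> borel_measurable M" "g \<in> borel_measurable M"
  shows "(\<lambda>x. fading_kernel \<alpha> (f x) (g x)) \<in> borel_measurable M"
  unfolding fading_kernel_def by measurable

lemma fading_kernel_nonneg:
  assumes "0 < \<alpha>" "\<alpha> < 1"
  shows "fading_kernel \<alpha> u v \<ge> 0"
  using assms by (auto simp: fading_kernel_def bessel_I0_nonneg power_le_one)

lemma one_minus_sq_pos:
  assumes "0 < (\<alpha>::real)" "\<alpha> < 1"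
  shows "1 - \<alpha>\<^sup>2 > 0"
  using assms by (simp add: abs_square_less_1)

lemma nn_integral_has_bochner_integral:
  fixes f :: "'a \<Rightarrow> real"
  assumes "has_bochner_integral M f x" "\<And>u. f u \<ge> 0"
  shows "(\<integral>\<^sup>+u. ennreal (f u) \<partial>M) = ennreal x"
  using assms by (auto simp: has_bochner_integral_iff nn_integral_eq_integral)

text \<open>These are the even moments of a Rayleigh density. The substitution
  \<open>u = sqrt s * x\<close> reduces them to the odd moments of \<open>exp (- x\<^sup>2)\<close>
  on the half-line.\<close>

lemma nn_integral_odd_gaussian:
  assumes "s > 0"
  shows "(\<integral>\<^sup>+u. ennreal (indicator {0..} u * (2 * u / s * exp (- u\<^sup>2 / s) * u ^ (2 * k))) \<partial>lborel)
    = ennreal (s ^ k * fact k)"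
proof -
  have "(\<integral>\<^sup>+u. ennreal (indicator {0..} u * (2 * u / s * exp (- u\<^sup>2 / s) * u ^ (2 * k))) \<partial>lborel)
    = ennreal (sqrt s) * (\<integral>\<^sup>+x. ennreal (indicator {0..} (sqrt s * x) * (2 * (sqrt s * x) / s *
          exp (- (sqrt s * x)\<^sup>2 / s) * (sqrt s * x) ^ (2 * k))) \<partial>lborel)"
    using assms by (subst nn_integral_real_affine[of _ "sqrt s" 0]) auto
  also have "\<dots> = (\<integral>\<^sup>+x. ennreal (2 * s ^ k * (indicator {0..} x *\<^sub>R (exp (- x\<^sup>2) * x ^ (2 * k + 1)))) \<partial>lborel)"
  proof (subst nn_integral_cmult[symmetric], simp, intro nn_integral_cong)
    fix x :: real
    have "sqrt s * (indicator {0..} (sqrt s * x) * (2 * (sqrt s * x) / s *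
          exp (- (sqrt s * x)\<^sup>2 / s) * (sqrt s * x) ^ (2 * k)))
        = 2 * s ^ k * (indicator {0..} x *\<^sub>R (exp (- x\<^sup>2) * x ^ (2 * k + 1)))"
    proof -
      obtain t where "t > 0" "s = t\<^sup>2"
        using assms by (metis real_sqrt_gt_0_iff real_sqrt_pow2 less_imp_le)
      then show ?thesis
        by (auto simp: indicator_def power_mult_distrib power_mult zero_le_mult_iff power2_eq_square)
    qed
    then show "ennreal (sqrt s) * ennreal (indicator {0..} (sqrt s * x) * (2 * (sqrt s * x) / s *
          exp (- (sqrt s * x)\<^sup>2 / s) * (sqrt s * x) ^ (2 * k)))
        = ennreal (2 * s ^ k * (indicator {0..} x *\<^sub>R (exp (- x\<^sup>2) * x ^ (2 * k + 1))))"
      using assms by (subst ennreal_mult'[symmetric]) auto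
  qed
  also have "\<dots> = ennreal (2 * s ^ k * (fact k / 2))"
    using has_bochner_integral_mult_right[OF gaussian_moment_odd_pos[of k], of "2 * s ^ k"] assms
    by (intro nn_integral_has_bochner_integral) (auto simp: indicator_def)
  finally show ?thesis by simp
qed

text \<open>Expanding \<open>bessel_I0\<close> termwise against the odd Gaussian moments gives the exponential
  series that cancels the factor \<open>exp (- \<alpha>\<^sup>2 v\<^sup>2 / (1 - \<alpha>\<^sup>2))\<close>.\<close>

lemma nn_integral_fading_kernel:
  assumes "0 < \<alpha>" "\<alpha> < 1"
  shows "(\<integral>\<^sup>+u. ennreal (fading_kernel \<alpha> u v) \<partial>lborel) = 1"
proof -
  define s where "s = 1 - \<alpha>\<^sup>2"
  have s: "s > 0" using one_minus_sq_pos[OF assms] by (simp add: s_def)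
  \<comment> \<open>The \<open>k\<close>-th term of the expanded kernel factors as
    \<open>a * b k * p k u\<close>: \<open>a\<close> and \<open>b k\<close> depend on
    \<open>v\<close> only, and \<open>p k\<close> is the integrand of the moment lemma.\<close>
  define a where "a = exp (- (\<alpha>\<^sup>2 * v\<^sup>2) / s)"
  define b where "b k = (\<alpha> * v / s) ^ (2 * k) / (fact k)\<^sup>2" for k
  define p where "p k u = indicator {0..} u * (2 * u / s * exp (- u\<^sup>2 / s) * u ^ (2 * k))"
    for k :: nat and u :: real
  have [simp]: "a \<ge> 0" "b k \<ge> 0" "p k u \<ge> 0" for k u
    using s by (auto simp: a_def b_def p_def indicator_def)
  have [measurable]: "p k \<in> borel_measurable borel" for k
    unfolding p_def[abs_def] by measurable
  have "ennreal (fading_kernel \<alpha> u v) = (\<Sum>k. ennreal (a * b k * p k u))" for u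
  proof -
    have t: "(2 * \<alpha> * u * v / s / 2) ^ (2 * k) / (fact k)\<^sup>2 = b k * u ^ (2 * k)" for k
      by (simp add: b_def power_mult_distrib power_divide)
    have "(\<lambda>k. (2 * \<alpha> * u * v / s / 2) ^ (2 * k) / (fact k)\<^sup>2) sums bessel_I0 (2 * \<alpha> * u * v / s)"
      unfolding bessel_I0_def by (rule summable_sums[OF summable_bessel_I0])
    then have "(\<lambda>k. indicator {0..} u * (2 * u / s) * exp (- u\<^sup>2 / s) * a * (b k * u ^ (2 * k)))
        sums (indicator {0..} u * (2 * u / s) * exp (- u\<^sup>2 / s) * a * bessel_I0 (2 * \<alpha> * u * v / s))"
      unfolding t by (rule sums_mult)
    moreover have "exp (- u\<^sup>2 / s) * a = exp (- (u\<^sup>2 + \<alpha>\<^sup>2 * v\<^sup>2) / s)"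
      by (simp add: a_def diff_divide_distrib flip: exp_add)
    then have "indicator {0..} u * (2 * u / s) * exp (- u\<^sup>2 / s) * a * bessel_I0 (2 * \<alpha> * u * v / s)
        = fading_kernel \<alpha> u v"
      by (simp add: fading_kernel_def indicator_def s_def mult.assoc)
    ultimately have "(\<lambda>k. a * b k * p k u) sums fading_kernel \<alpha> u v"
      by (simp add: p_def mult_ac)
    then show ?thesis
      by (intro suminf_ennreal_eq[symmetric]) auto
  qed
  \<comment> \<open>All terms are nonnegative, so sum and integral interchange without further
    conditions.\<close>
  then have "(\<integral>\<^sup>+u. ennreal (fading_kernel \<alpha> u v) \<partial>lborel) = (\<Sum>k. \<integral>\<^sup>+u. ennreal (a * b k * p k u) \<partial>lborel)"
    by (simp add: nn_integral_suminf)
  also have "(\<lambda>k. \<integral>\<^sup>+u. ennreal (a * b k * p k u) \<partial>lborel) = (\<lambda>k. ennreal (a * (((\<alpha> * v)\<^sup>2 / s) ^ k / fact k)))"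
  proof (rule ext)
    fix k
    have "(\<integral>\<^sup>+u. ennreal (a * b k * p k u) \<partial>lborel) = ennreal (a * b k) * (\<integral>\<^sup>+u. ennreal (p k u) \<partial>lborel)"
      by (simp add: ennreal_mult nn_integral_cmult)
    also have "\<dots> = ennreal (a * b k * (s ^ k * fact k))"
      using nn_integral_odd_gaussian[OF s, of k] s by (simp add: p_def ennreal_mult')
    also have "a * b k * (s ^ k * fact k) = a * (((\<alpha> * v)\<^sup>2 / s) ^ k / fact k)"
      using s by (simp add: b_def power_mult power_divide power2_eq_square power_mult_distrib)
    finally show "(\<integral>\<^sup>+u. ennreal (a * b k * p k u) \<partial>lborel) = ennreal (a * (((\<alpha> * v)\<^sup>2 / s) ^ k / fact k))" .
  qed
  also have "(\<Sum>k. ennreal (a * (((\<alpha> * v)\<^sup>2 / s) ^ k / fact k))) = ennreal (a * exp ((\<alpha> * v)\<^sup>2 / s))"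
    using s exp_converges[of "(\<alpha> * v)\<^sup>2 / s"]
    by (intro suminf_ennreal_eq sums_mult) (auto simp: field_simps)
  also have "a * exp ((\<alpha> * v)\<^sup>2 / s) = 1"
    by (simp add: a_def power_mult_distrib flip: exp_add)
  finally show ?thesis by simp
qed

section \<open>Gaussian domination and tails of the kernel\<close>

text \<open>The bound \<open>bessel_I0 z \<le> exp z\<close> completes the square in the exponent.
  With \<open>\<bar>u\<bar>\<close> in place of \<open>u\<close> the bound stays nonnegative for
  negative \<open>u\<close>, so full-line Gaussian moments apply.\<close>

lemma fading_kernel_le_gaussian:
  assumes "0 < \<alpha>" "\<alpha> < 1" "v \<ge> 0"
  shows "fading_kernel \<alpha> u v \<le> 2 * \<bar>u\<bar> / (1 - \<alpha>\<^sup>2) * exp (- (u - \<alpha> * v)\<^sup>2 / (1 - \<alpha>\<^sup>2))"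
proof (cases "u \<ge> 0")
  case True
  have s: "1 - \<alpha>\<^sup>2 > 0" using one_minus_sq_pos[OF assms(1,2)] .
  have "fading_kernel \<alpha> u v \<le> 2 * u / (1 - \<alpha>\<^sup>2) * exp (- (u\<^sup>2 + \<alpha>\<^sup>2 * v\<^sup>2) / (1 - \<alpha>\<^sup>2)) *
      exp (2 * \<alpha> * u * v / (1 - \<alpha>\<^sup>2))"
    using True s assms by (simp only: fading_kernel_def if_True) (intro mult_left_mono bessel_I0_le_exp; simp)
  also have "\<dots> = 2 * u / (1 - \<alpha>\<^sup>2) * exp (- (u - \<alpha> * v)\<^sup>2 / (1 - \<alpha>\<^sup>2))"
    using s by (simp add: mult.assoc power2_eq_square algebra_simps diff_divide_distrib add_divide_distrib flip: exp_add)
  finally show ?thesis using True by simp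
next
  case False
  have "fading_kernel \<alpha> u v = 0" using False by (simp add: fading_kernel_def)
  also have "0 \<le> 2 * \<bar>u\<bar> / (1 - \<alpha>\<^sup>2) * exp (- (u - \<alpha> * v)\<^sup>2 / (1 - \<alpha>\<^sup>2))"
    using one_minus_sq_pos[OF assms(1,2)] by (intro mult_nonneg_nonneg divide_nonneg_pos) auto
  finally show ?thesis .
qed

text \<open>One term of the exponential series. It trades exponential decay for power decay of any
  order.\<close>

lemma power_le_fact_exp:
  assumes "(x::real) \<ge> 0"
  shows "x ^ n \<le> fact n * exp x"
proof -
  have "(\<Sum>k\<in>{n}. x ^ k /\<^sub>R fact k) \<le> (\<Sum>k. x ^ k /\<^sub>R fact k)"
    using assms by (intro sum_le_suminf summable_exp_generic) auto
  then show ?thesis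
    by (simp add: exp_def field_simps)
qed

text \<open>Half of the Gaussian exponent pays for the decay, the other half keeps the integral finite.\<close>

lemma fading_kernel_tail_exp:
  assumes "0 < \<alpha>" "\<alpha> < 1"
  obtains B where "B > 0"
    "\<And>v. v > 0 \<Longrightarrow> (\<integral>\<^sup>+u. ennreal (fading_kernel \<alpha> u v * indicator {u. \<bar>u - \<alpha> * v\<bar> > sqrt v} u) \<partial>lborel)
        \<le> ennreal (B * (1 + v) * exp (- v / (2 * (1 - \<alpha>\<^sup>2))))"
proof
  define s where "s = 1 - \<alpha>\<^sup>2"
  have s: "s > 0" using one_minus_sq_pos[OF assms] by (simp add: s_def)
  \<comment> \<open>The remaining half \<open>exp (- (u - m)\<^sup>2 / (2 * s))\<close> is a normal
    density of variance \<open>s\<close>, up to the factor \<open>sqrt (2 * pi * s)\<close>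
    collected in \<open>A\<close>.\<close>
  define \<sigma> where "\<sigma> = sqrt s"
  have \<sigma>: "\<sigma> > 0" "\<sigma>\<^sup>2 = s" using s by (auto simp: \<sigma>_def)
  define A where "A = 2 / s * sqrt (2 * pi * s)"
  have A: "A > 0" using s by (simp add: A_def)
  define B where "B = A * (\<sigma> * sqrt (2 / pi) + 1)"
  show "B > 0" using A \<sigma> by (simp add: B_def add_nonneg_pos)
  fix v :: real assume v: "v > 0"
  define m where "m = \<alpha> * v"
  have m: "0 \<le> m" "m \<le> v" using assms v by (auto simp: m_def mult_left_le_one_le)
  define E where "E = exp (- v / (2 * s))"
  \<comment> \<open>Splitting \<open>\<bar>u\<bar> \<le> \<bar>u - m\<bar> + m\<close> leaves the
    first absolute central moment and the total mass; the exponent \<open>2 * 0 + 1\<close> matches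
    the form of the library's odd moments.\<close>
  have pt: "fading_kernel \<alpha> u v * indicator {u. \<bar>u - \<alpha> * v\<bar> > sqrt v} u
      \<le> A * E * (normal_density m \<sigma> u * \<bar>u - m\<bar> ^ (2 * 0 + 1) + m * normal_density m \<sigma> u)" for u
  proof (cases "\<bar>u - m\<bar> > sqrt v")
    case True
    then have "(sqrt v)\<^sup>2 < \<bar>u - m\<bar>\<^sup>2" using v by (intro power_strict_mono) auto
    then have "v < (u - m)\<^sup>2" using v by simp
    then have "- (u - m)\<^sup>2 / s \<le> - v / (2 * s) + - (u - m)\<^sup>2 / (2 * s)"
      using s by (simp add: field_simps)
    then have e: "exp (- (u - m)\<^sup>2 / s) \<le> E * exp (- (u - m)\<^sup>2 / (2 * s))"
      unfolding E_def exp_add[symmetric] by (simp only: exp_le_cancel_iff)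
    have "fading_kernel \<alpha> u v \<le> 2 * \<bar>u\<bar> / s * exp (- (u - m)\<^sup>2 / s)"
      using fading_kernel_le_gaussian[OF assms, of v u] v by (simp add: s_def m_def)
    also have "\<dots> \<le> 2 * (\<bar>u - m\<bar> + m) / s * (E * exp (- (u - m)\<^sup>2 / (2 * s)))"
      using s m by (intro mult_mono divide_right_mono e) auto
    also have "exp (- (u - m)\<^sup>2 / (2 * s)) = sqrt (2 * pi * s) * normal_density m \<sigma> u"
      using s by (simp add: normal_density_def \<sigma>(2))
    also have "2 * (\<bar>u - m\<bar> + m) / s * (E * (sqrt (2 * pi * s) * normal_density m \<sigma> u))
        = A * E * (normal_density m \<sigma> u * \<bar>u - m\<bar> ^ (2 * 0 + 1) + m * normal_density m \<sigma> u)"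
      using s by (simp add: A_def field_simps)
    finally show ?thesis using True by (simp add: m_def)
  next
    case False
    then show ?thesis using A m by (simp add: m_def E_def)
  qed
  have hb: "has_bochner_integral lborel
      (\<lambda>u. A * E * (normal_density m \<sigma> u * \<bar>u - m\<bar> ^ (2 * 0 + 1) + m * normal_density m \<sigma> u))
      (A * E * (2 ^ 0 * \<sigma> ^ (2 * 0 + 1) * fact 0 * sqrt (2 / pi) + m * 1))"
    using \<sigma>(1) by (intro has_bochner_integral_mult_right has_bochner_integral_add normal_moment_abs_odd)
      (auto simp: has_bochner_integral_iff)
  have "(\<integral>\<^sup>+u. ennreal (fading_kernel \<alpha> u v * indicator {u. \<bar>u - \<alpha> * v\<bar> > sqrt v} u) \<partial>lborel)
      \<le> (\<integral>\<^sup>+u. ennreal (A * E * (normal_density m \<sigma> u * \<bar>u - m\<bar> ^ (2 * 0 + 1) + m * normal_density m \<sigma> u)) \<partial>lborel)"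
    by (intro nn_integral_mono ennreal_leI pt)
  also have "\<dots> = ennreal (A * E * (2 ^ 0 * \<sigma> ^ (2 * 0 + 1) * fact 0 * sqrt (2 / pi) + m * 1))"
    using A m by (intro nn_integral_has_bochner_integral[OF hb]) (auto simp: E_def)
  also have "\<dots> \<le> ennreal (B * (1 + v) * exp (- v / (2 * (1 - \<alpha>\<^sup>2))))"
  proof (rule ennreal_leI)
    have "\<sigma> * sqrt (2 / pi) + m \<le> (\<sigma> * sqrt (2 / pi) + 1) * (1 + v)"
    proof -
      have "0 \<le> \<sigma> * sqrt (2 / pi) * v" using \<sigma> v by simp
      then show ?thesis using m v by (simp only: distrib_left distrib_right)
    qed
    from mult_left_mono[OF this, of "A * E"] 
    show "A * E * (2 ^ 0 * \<sigma> ^ (2 * 0 + 1) * fact 0 * sqrt (2 / pi) + m * 1)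
        \<le> B * (1 + v) * exp (- v / (2 * (1 - \<alpha>\<^sup>2)))"
      using A by (simp add: B_def E_def s_def mult_ac)
  qed
  finally show "(\<integral>\<^sup>+u. ennreal (fading_kernel \<alpha> u v * indicator {u. \<bar>u - \<alpha> * v\<bar> > sqrt v} u) \<partial>lborel)
        \<le> ennreal (B * (1 + v) * exp (- v / (2 * (1 - \<alpha>\<^sup>2))))" .
qed

text \<open>The order \<open>n\<close> is free, so the tail can be made negligible against any
  function of known polynomial decay.\<close>

lemma fading_kernel_tail_power:
  assumes "0 < \<alpha>" "\<alpha> < 1"
  obtains C where "C > 0"
    "\<And>v. v \<ge> 1 \<Longrightarrow> (\<integral>\<^sup>+u. ennreal (fading_kernel \<alpha> u v * indicator {u. \<bar>u - \<alpha> * v\<bar> > sqrt v} u) \<partial>lborel)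
        \<le> ennreal (C / v ^ n)"
proof -
  obtain B where B: "B > 0"
    "\<And>v. v > 0 \<Longrightarrow> (\<integral>\<^sup>+u. ennreal (fading_kernel \<alpha> u v * indicator {u. \<bar>u - \<alpha> * v\<bar> > sqrt v} u) \<partial>lborel)
        \<le> ennreal (B * (1 + v) * exp (- v / (2 * (1 - \<alpha>\<^sup>2))))"
    using fading_kernel_tail_exp[OF assms] by blast
  define r where "r = 2 * (1 - \<alpha>\<^sup>2)"
  have r: "r > 0" using one_minus_sq_pos[OF assms] by (simp add: r_def)
  define C where "C = 2 * B * (fact (Suc n) * r ^ Suc n)"
  show ?thesis
  proof
    show "C > 0" using B r by (simp add: C_def)
    fix v :: real assume v: "v \<ge> 1"
    \<comment> \<open>One power more than \<open>n\<close>, because the factor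
      \<open>1 + v \<le> 2 * v\<close> consumes one.\<close>
    have "(v / r) ^ Suc n \<le> fact (Suc n) * exp (v / r)"
      using r v by (intro power_le_fact_exp) auto
    then have "exp (- v / r) \<le> fact (Suc n) * r ^ Suc n / v ^ Suc n"
      using r v by (simp add: exp_minus divide_simps del: fact_Suc power_Suc) (simp add: mult_ac del: fact_Suc power_Suc)
    then have "B * (1 + v) * exp (- v / r) \<le> B * (2 * v) * (fact (Suc n) * r ^ Suc n / v ^ Suc n)"
      using B v by (intro mult_mono) auto
    also have "\<dots> = C / v ^ n"
      using v by (simp add: C_def)
    finally have "ennreal (B * (1 + v) * exp (- v / r)) \<le> ennreal (C / v ^ n)"
      by (rule ennreal_leI)
    then show "(\<integral>\<^sup>+u. ennreal (fading_kernel \<alpha> u v * indicator {u. \<bar>u - \<alpha> * v\<bar> > sqrt v} u) \<partial>lborel)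
        \<le> ennreal (C / v ^ n)"
      using B(2)[of v] v by (auto simp: r_def intro: order_trans)
  qed
qed

section \<open>The expectation over the chain as an iterated operator\<close>

text \<open>Total mass 1 makes the integrand integrable. This links the Lebesgue integral of the
  definitions to the nonnegative integral in which the estimates are made.\<close>

lemma fading_average:
  assumes "0 < \<alpha>" "\<alpha> < 1" and [measurable]: "f \<in> borel_measurable borel"
    and f: "\<And>u. 0 \<le> f u" "\<And>u. f u \<le> 1"
  shows "ennreal (LINT u|lborel. fading_kernel \<alpha> u v * f u)
      = (\<integral>\<^sup>+u. ennreal (fading_kernel \<alpha> u v * f u) \<partial>lborel)"
    and "0 \<le> (LINT u|lborel. fading_kernel \<alpha> u v * f u)"
    and "(LINT u|lborel. fading_kernel \<alpha> u v * f u) \<le> 1"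
proof -
  note q = fading_kernel_nonneg[OF assms(1,2)]
  have "(\<integral>\<^sup>+u. ennreal (fading_kernel \<alpha> u v * f u) \<partial>lborel) \<le> (\<integral>\<^sup>+u. ennreal (fading_kernel \<alpha> u v) \<partial>lborel)"
    using f q by (intro nn_integral_mono ennreal_leI mult_right_le_one_le) auto
  then have le: "(\<integral>\<^sup>+u. ennreal (fading_kernel \<alpha> u v * f u) \<partial>lborel) \<le> 1"
    using nn_integral_fading_kernel[OF assms(1,2)] by simp
  have "integrable lborel (\<lambda>u. fading_kernel \<alpha> u v * f u)"
    using le f q by (intro integrableI_nonneg) (auto simp: less_top intro: le_less_trans)
  then show *: "ennreal (LINT u|lborel. fading_kernel \<alpha> u v * f u)
      = (\<integral>\<^sup>+u. ennreal (fading_kernel \<alpha> u v * f u) \<partial>lborel)"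
    using f q by (subst nn_integral_eq_integral) auto
  show "0 \<le> (LINT u|lborel. fading_kernel \<alpha> u v * f u)"
    using f q by (intro integral_nonneg_AE) auto
  show "(LINT u|lborel. fading_kernel \<alpha> u v * f u) \<le> 1"
    using le by (simp flip: *)
qed

text \<open>The Markov transition operator with multiplicative weight \<open>w\<close>, of
  Feynman-Kac type.\<close>

definition fading_step :: "real \<Rightarrow> (real \<Rightarrow> real) \<Rightarrow> (real \<Rightarrow> real) \<Rightarrow> real \<Rightarrow> real" where
  "fading_step \<alpha> w f v = (LINT u|lborel. fading_kernel \<alpha> u v * (w u * f u))"

lemma fading_step_measurable [measurable]:
  assumes [measurable]: "w \<in> borel_measurable borel" "f \<in> borel_measurable borel"
  shows "fading_step \<alpha> w f \<in> borel_measurable borel"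
  unfolding fading_step_def[abs_def] by measurable

lemma fading_step_bounds:
  assumes "0 < \<alpha>" "\<alpha> < 1" "w \<in> borel_measurable borel" "f \<in> borel_measurable borel"
    and "\<And>u. 0 \<le> w u" "\<And>u. w u \<le> 1" "\<And>u. 0 \<le> f u" "\<And>u. f u \<le> 1"
  shows "0 \<le> fading_step \<alpha> w f v" "fading_step \<alpha> w f v \<le> 1"
  unfolding fading_step_def using assms
  by (auto intro!: fading_average mult_le_one)

lemma fading_density_nonneg:
  assumes "0 < \<alpha>" "\<alpha> < 1"
  shows "fading_density \<alpha> N u0 u \<ge> 0"
  unfolding fading_density_def by (intro prod_nonneg fading_kernel_nonneg[OF assms])

lemma fading_density_measurable [measurable]:
  "fading_density \<alpha> N u0 \<in> borel_measurable (Pi\<^sub>M {1..N} (\<lambda>_. lborel))"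
  unfolding fading_density_def[abs_def]
proof (intro borel_measurable_prod fading_kernel_measurable)
  fix i assume i: "i \<in> {1..N}"
  then show "(\<lambda>u. u i) \<in> borel_measurable (Pi\<^sub>M {1..N} (\<lambda>_. lborel))"
    by measurable
  show "(\<lambda>u. if i = 1 then u0 else u (i - 1)) \<in> borel_measurable (Pi\<^sub>M {1..N} (\<lambda>_. lborel))"
  proof (cases "i = 1")
    case False
    then have "i - 1 \<in> {1..N}" using i by auto
    then have "(\<lambda>u. u (i - 1)) \<in> borel_measurable (Pi\<^sub>M {1..N} (\<lambda>_. lborel))"
      by measurable
    then show ?thesis using False by simp
  qed simp
qed

text \<open>The Markov property: the new gain meets only its predecessor, which for
  \<open>N = 0\<close> is \<open>u0\<close> and not \<open>x 0\<close>.\<close>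

lemma fading_density_Suc:
  "fading_density \<alpha> (Suc N) u0 (x(Suc N := y))
    = fading_density \<alpha> N u0 x * fading_kernel \<alpha> y (if N = 0 then u0 else x N)"
proof -
  have "(\<Prod>i\<in>{1..N}. fading_kernel \<alpha> ((x(Suc N := y)) i) (if i = 1 then u0 else (x(Suc N := y)) (i - 1)))
      = fading_density \<alpha> N u0 x"
    unfolding fading_density_def by (intro prod.cong) auto
  then show ?thesis
    by (simp add: fading_density_def)
qed

text \<open>The test function \<open>f\<close> of the last gain lets the induction integrate out the last coordinate,
  which avoids shifting the indices of the product measure.\<close>

lemma nn_integral_fading_chain:
  assumes \<alpha>: "0 < \<alpha>" "\<alpha> < 1"
    and w [measurable]: "w \<in> borel_measurable borel" and w01: "\<And>u. 0 \<le> w u" "\<And>u. w u \<le> 1"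
    and f [measurable]: "f \<in> borel_measurable borel" and f01: "\<And>u. 0 \<le> f u" "\<And>u. f u \<le> 1"
  shows "(\<integral>\<^sup>+u. ennreal (fading_density \<alpha> N u0 u * (\<Prod>i\<in>{1..N}. w (u i)) * f (if N = 0 then u0 else u N))
      \<partial>Pi\<^sub>M {1..N} (\<lambda>_. lborel)) = ennreal ((fading_step \<alpha> w ^^ N) f u0)"
  using f f01
proof (induction N arbitrary: f)
  case 0
  interpret product_sigma_finite "\<lambda>_::nat. lborel :: real measure" ..
  show ?case by (simp add: PiM_empty fading_density_def)
next
  case (Suc N)
  interpret product_sigma_finite "\<lambda>_::nat. lborel :: real measure" ..
  note [measurable] = Suc.prems(1)
  let ?D = "\<lambda>u. fading_density \<alpha> N u0 u * (\<Prod>i\<in>{1..N}. w (u i))"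
  let ?p = "\<lambda>u. if N = 0 then u0 else u N"
  have ins: "{1..Suc N} = insert (Suc N) {1..N}" by auto
  have "(\<integral>\<^sup>+u. ennreal (fading_density \<alpha> (Suc N) u0 u * (\<Prod>i\<in>{1..Suc N}. w (u i)) *
        f (if Suc N = 0 then u0 else u (Suc N))) \<partial>Pi\<^sub>M {1..Suc N} (\<lambda>_. lborel))
    = (\<integral>\<^sup>+x. (\<integral>\<^sup>+y. ennreal (fading_density \<alpha> (Suc N) u0 (x(Suc N := y)) *
          (\<Prod>i\<in>{1..Suc N}. w ((x(Suc N := y)) i)) * f y) \<partial>lborel) \<partial>Pi\<^sub>M {1..N} (\<lambda>_. lborel))"
  proof -
    have "(\<lambda>u. ennreal (fading_density \<alpha> (Suc N) u0 u * (\<Prod>i\<in>{1..Suc N}. w (u i)) *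
        f (if Suc N = 0 then u0 else u (Suc N)))) \<in> borel_measurable (Pi\<^sub>M {1..Suc N} (\<lambda>_. lborel))"
      by measurable
    from product_nn_integral_insert[OF _ _ this[unfolded ins]] show ?thesis
      by (simp only: flip: ins) simp
  qed
  also have "\<dots> = (\<integral>\<^sup>+x. ennreal (?D x * fading_step \<alpha> w f (?p x)) \<partial>Pi\<^sub>M {1..N} (\<lambda>_. lborel))"
  proof (rule nn_integral_cong)
    fix x :: "nat \<Rightarrow> real"
    have D: "?D x \<ge> 0"
      using w01 by (intro mult_nonneg_nonneg fading_density_nonneg[OF \<alpha>] prod_nonneg) auto
    have e: "fading_density \<alpha> (Suc N) u0 (x(Suc N := y)) * (\<Prod>i\<in>{1..Suc N}. w ((x(Suc N := y)) i)) * f y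
        = ?D x * (fading_kernel \<alpha> y (?p x) * (w y * f y))" for y
    proof -
      have "(\<Prod>i\<in>{1..Suc N}. w ((x(Suc N := y)) i)) = (\<Prod>i\<in>{1..N}. w (x i)) * w y"
      proof -
        have "(\<Prod>i\<in>{1..N}. w ((x(Suc N := y)) i)) = (\<Prod>i\<in>{1..N}. w (x i))"
          by (intro prod.cong) auto
        then show ?thesis by simp
      qed
      then show ?thesis unfolding fading_density_Suc by (simp only: mult_ac)
    qed
    have "(\<integral>\<^sup>+y. ennreal (?D x * (fading_kernel \<alpha> y (?p x) * (w y * f y))) \<partial>lborel)
        = ennreal (?D x) * (\<integral>\<^sup>+y. ennreal (fading_kernel \<alpha> y (?p x) * (w y * f y)) \<partial>lborel)"
      using D by (simp only: ennreal_mult') (intro nn_integral_cmult; measurable)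
    also have "\<dots> = ennreal (?D x * fading_step \<alpha> w f (?p x))"
    proof -
      have "(\<lambda>y. w y * f y) \<in> borel_measurable borel" by measurable
      from fading_average(1)[OF \<alpha> this] show ?thesis
        unfolding fading_step_def using D w01 Suc.prems
        by (simp add: ennreal_mult' mult_le_one)
    qed
    finally show "(\<integral>\<^sup>+y. ennreal (fading_density \<alpha> (Suc N) u0 (x(Suc N := y)) *
          (\<Prod>i\<in>{1..Suc N}. w ((x(Suc N := y)) i)) * f y) \<partial>lborel)
        = ennreal (?D x * fading_step \<alpha> w f (?p x))"
      unfolding e .
  qed
  \<comment> \<open>The induction hypothesis is applied to the new test function
    \<open>fading_step \<alpha> w f\<close>; hence the generalisation over \<open>f\<close>.\<close>
  also have "\<dots> = ennreal ((fading_step \<alpha> w ^^ N) (fading_step \<alpha> w f) u0)"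
    using Suc.prems w01 by (intro Suc.IH fading_step_measurable fading_step_bounds \<alpha> w)
  also have "\<dots> = ennreal ((fading_step \<alpha> w ^^ Suc N) f u0)"
    by (simp add: funpow_swap1)
  finally show ?case .
qed

lemma integral_fading_law:
  assumes \<alpha>: "0 < \<alpha>" "\<alpha> < 1"
    and w [measurable]: "w \<in> borel_measurable borel" and w01: "\<And>u. 0 \<le> w u" "\<And>u. w u \<le> 1"
  shows "(LINT u|fading_law \<alpha> N u0. (\<Prod>i\<in>{1..N}. w (u i))) = (fading_step \<alpha> w ^^ N) (\<lambda>_. 1) u0"
proof -
  \<comment> \<open>Measurability and bounds carry the induction; nonnegativity at \<open>u0\<close>
    finally lets \<open>enn2real\<close> undo \<open>ennreal\<close>.\<close>
  have nn: "0 \<le> (fading_step \<alpha> w ^^ N) (\<lambda>_. 1) u0 \<and> (fading_step \<alpha> w ^^ N) (\<lambda>_. 1) \<in> borel_measurable borel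
      \<and> (\<forall>v. 0 \<le> (fading_step \<alpha> w ^^ N) (\<lambda>_. 1) v \<and> (fading_step \<alpha> w ^^ N) (\<lambda>_. 1) v \<le> 1)"
    by (induction N) (auto intro!: fading_step_bounds fading_step_measurable \<alpha> w w01)
  have "(LINT u|fading_law \<alpha> N u0. (\<Prod>i\<in>{1..N}. w (u i)))
      = (LINT u|Pi\<^sub>M {1..N} (\<lambda>_. lborel). fading_density \<alpha> N u0 u * (\<Prod>i\<in>{1..N}. w (u i)))"
    unfolding fading_law_def using fading_density_nonneg[OF \<alpha>]
    by (subst integral_density) (auto simp del: One_nat_def)
  also have "\<dots> = enn2real (\<integral>\<^sup>+u. ennreal (fading_density \<alpha> N u0 u * (\<Prod>i\<in>{1..N}. w (u i)))
      \<partial>Pi\<^sub>M {1..N} (\<lambda>_. lborel))"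
    using w01 by (intro integral_eq_nn_integral)
      (auto intro!: mult_nonneg_nonneg fading_density_nonneg[OF \<alpha>] prod_nonneg simp del: One_nat_def)
  also have "\<dots> = (fading_step \<alpha> w ^^ N) (\<lambda>_. 1) u0"
    using nn_integral_fading_chain[OF \<alpha> w w01, of "\<lambda>_. 1" N u0] nn by simp
  finally show ?thesis .
qed

section \<open>Functions of polynomial decay\<close>

text \<open>Equivalently, \<open>ln H\<close> is a nonincreasing and \<open>m\<close>-Lipschitz function of \<open>ln x\<close>.\<close>

definition polynomially_decaying :: "nat \<Rightarrow> (real \<Rightarrow> real) \<Rightarrow> bool" where
  "polynomially_decaying m H \<longleftrightarrow> (\<forall>x>0. H x > 0) \<and>
     (\<forall>x u. 0 < x \<longrightarrow> x \<le> u \<longrightarrow> H u \<le> H x \<and> H x \<le> H u * (u / x) ^ m)"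

text \<open>On this range \<open>(1 - t) * (1 + 2 * t) \<ge> 1\<close>. The lemma turns a relative
  loss \<open>t\<close> into an exponential factor.\<close>

lemma exp_minus_double_le:
  assumes "0 \<le> (t::real)" "t \<le> 1 / 2"
  shows "exp (- (2 * t)) \<le> 1 - t"
proof -
  have "t * (2 * t) \<le> t * 1" using assms by (intro mult_left_mono) auto
  then have "1 \<le> (1 - t) * (1 + 2 * t)" by (simp add: algebra_simps)
  also have "\<dots> \<le> (1 - t) * exp (2 * t)" using assms by (intro mult_left_mono) auto
  finally show ?thesis by (simp add: exp_minus field_simps)
qed

text \<open>A relative displacement of at most \<open>t \<le> 1 / 2\<close>, up or down, changes the
  argument by a factor of at most \<open>exp (2 * t)\<close>, and polynomial decay raises this
  factor to the power \<open>m\<close>.\<close>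

lemma polynomially_decaying_near:
  fixes t :: real
  assumes H: "polynomially_decaying m H" and "0 < x" "0 \<le> t" "t \<le> 1 / 2"
    and u: "x * (1 - t) \<le> u" "u \<le> x * (1 + t)"
  shows "H x * exp (- (2 * real m * t)) \<le> H u" "H u \<le> H x * exp (2 * real m * t)"
proof -
  have "0 < x * (1 - t)" using assms by simp
  then have u0: "u > 0" using u by linarith
  have pos: "H x > 0" "H u > 0"
    using H \<open>0 < x\<close> u0 by (auto simp: polynomially_decaying_def)
  have e: "exp (2 * real m * t) = exp (2 * t) ^ m"
    by (simp add: mult_ac flip: exp_of_nat_mult)
  have e1: "1 \<le> exp (2 * real m * t)" using assms by simp
  have "H x \<le> H u * exp (2 * real m * t) \<and> H u \<le> H x * exp (2 * real m * t)"
  proof (cases "x \<le> u")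
    case True
    then have *: "H u \<le> H x" "H x \<le> H u * (u / x) ^ m"
      using H \<open>0 < x\<close> by (auto simp: polynomially_decaying_def)
    have "u / x \<le> 1 + t" using u \<open>0 < x\<close> by (simp add: field_simps)
    also have "\<dots> \<le> exp (2 * t)"
      using exp_ge_add_one_self[of "2 * t"] assms by linarith
    finally have "(u / x) ^ m \<le> exp (2 * real m * t)"
      unfolding e using u0 \<open>0 < x\<close> by (intro power_mono) auto
    then have "H u * (u / x) ^ m \<le> H u * exp (2 * real m * t)" using pos by simp
    moreover have "H x * 1 \<le> H x * exp (2 * real m * t)" using pos e1 by (intro mult_left_mono) auto
    ultimately show ?thesis using * by auto
  next
    case False
    then have *: "H x \<le> H u" "H u \<le> H x * (x / u) ^ m"
      using H u0 by (auto simp: polynomially_decaying_def)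
    have "x * exp (- (2 * t)) \<le> u"
      using exp_minus_double_le[OF assms(3,4)] u \<open>0 < x\<close>
      by (smt (verit) mult_left_mono)
    then have "x / u \<le> exp (2 * t)" using u0 by (simp add: exp_minus field_simps)
    then have "(x / u) ^ m \<le> exp (2 * real m * t)"
      unfolding e using u0 \<open>0 < x\<close> by (intro power_mono) auto
    then have "H x * (x / u) ^ m \<le> H x * exp (2 * real m * t)" using pos by simp
    moreover have "H u * 1 \<le> H u * exp (2 * real m * t)" using pos e1 by (intro mult_left_mono) auto
    ultimately show ?thesis using * by auto
  qed
  then show "H x * exp (- (2 * real m * t)) \<le> H u" "H u \<le> H x * exp (2 * real m * t)"
    by (auto simp: exp_minus field_simps)
qed

lemma polynomially_decaying_mult:
  assumes F: "polynomially_decaying m F" and G: "polynomially_decaying n G"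
  shows "polynomially_decaying (m + n) (\<lambda>x. F x * G x)"
  unfolding polynomially_decaying_def
proof (intro conjI allI impI)
  fix x u :: real assume xu: "0 < x" "x \<le> u"
  have pos: "F x > 0" "F u > 0" "G x > 0" "G u > 0"
    using F G xu by (auto simp: polynomially_decaying_def)
  have le: "F u \<le> F x" "F x \<le> F u * (u / x) ^ m" "G u \<le> G x" "G x \<le> G u * (u / x) ^ n"
    using F G xu by (auto simp: polynomially_decaying_def)
  show "F u * G u \<le> F x * G x"
    using le pos by (intro mult_mono) auto
  have "F x * G x \<le> (F u * (u / x) ^ m) * (G u * (u / x) ^ n)"
    using le pos xu by (intro mult_mono) auto
  then show "F x * G x \<le> F u * G u * (u / x) ^ (m + n)"
    by (simp add: power_add mult_ac)
qed (use F G in \<open>auto simp: polynomially_decaying_def\<close>)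

lemma polynomially_decaying_prod:
  assumes "finite I" "\<And>i. i \<in> I \<Longrightarrow> polynomially_decaying m (F i)"
  shows "polynomially_decaying (card I * m) (\<lambda>x. \<Prod>i\<in>I. F i x)"
  using assms
proof (induction I rule: finite_induct)
  case empty
  show ?case by (simp add: polynomially_decaying_def)
next
  case (insert i I)
  then show ?case
    using polynomially_decaying_mult[of m "F i" "card I * m" "\<lambda>x. \<Prod>i\<in>I. F i x"] by simp
qed

text \<open>Keeping \<open>c\<close> as a parameter absorbs a scaling of the gain: evaluation at
  \<open>\<alpha> * u\<close> replaces \<open>c\<close> by
  \<open>c * \<alpha>\<^sup>2\<close>.\<close>

definition gain_factor :: "real \<Rightarrow> real \<Rightarrow> real \<Rightarrow> real" where
  "gain_factor \<rho> c u = (1 / (1 + c * u\<^sup>2)) powr \<rho>"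

lemma gain_factor_measurable [measurable]: "gain_factor \<rho> c \<in> borel_measurable borel"
  unfolding gain_factor_def[abs_def] by measurable

lemma gain_factor_bounds:
  assumes "c > 0" "0 \<le> \<rho>"
  shows "0 \<le> gain_factor \<rho> c u" "gain_factor \<rho> c u \<le> 1"
proof -
  have "1 / (1 + c * u\<^sup>2) \<le> 1" using assms by (simp add: divide_simps add_nonneg_eq_0_iff)
  then have "(1 / (1 + c * u\<^sup>2)) powr \<rho> \<le> 1 powr \<rho>"
    using assms by (intro powr_mono2) auto
  then show "gain_factor \<rho> c u \<le> 1" by (simp add: gain_factor_def)
qed (simp add: gain_factor_def)

text \<open>The base \<open>1 / (1 + c * u\<^sup>2)\<close> loses at most the factor
  \<open>(u / x)\<^sup>2\<close>. As this ratio is at least 1 and \<open>\<rho> \<le> 1\<close>,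
  raising it to the power \<open>\<rho>\<close> does not increase it.\<close>

lemma polynomially_decaying_gain_factor:
  assumes "c > 0" "0 \<le> \<rho>" "\<rho> \<le> 1"
  shows "polynomially_decaying 2 (gain_factor \<rho> c)"
  unfolding polynomially_decaying_def
proof (intro conjI allI impI)
  have p: "1 + c * x\<^sup>2 > 0" for x using assms by (simp add: add_pos_nonneg)
  then show "gain_factor \<rho> c x > 0" for x by (simp add: gain_factor_def less_imp_neq[THEN not_sym])
  fix x u :: real assume xu: "0 < x" "x \<le> u"
  have sq: "x\<^sup>2 \<le> u\<^sup>2" using xu by (intro power_mono) auto
  show "gain_factor \<rho> c u \<le> gain_factor \<rho> c x"
    unfolding gain_factor_def using p assms sq
    by (intro powr_mono2 divide_left_mono mult_pos_pos) (auto simp: less_imp_le)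
  have r: "1 \<le> (u / x)\<^sup>2" using xu by (simp add: one_le_power)
  have "1 / (1 + c * x\<^sup>2) \<le> (u / x)\<^sup>2 * (1 / (1 + c * u\<^sup>2))"
  proof -
    have "x\<^sup>2 * (1 + c * u\<^sup>2) \<le> u\<^sup>2 * (1 + c * x\<^sup>2)" using sq by (simp add: algebra_simps)
    then show ?thesis using p[of x] p[of u] xu by (simp add: power_divide divide_simps mult_ac)
  qed
  then have "gain_factor \<rho> c x \<le> ((u / x)\<^sup>2 * (1 / (1 + c * u\<^sup>2))) powr \<rho>"
    unfolding gain_factor_def using p[of x] assms by (intro powr_mono2) auto
  also have "\<dots> = ((u / x)\<^sup>2) powr \<rho> * gain_factor \<rho> c u"
    unfolding gain_factor_def using p[of u] by (intro powr_mult)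
  also have "\<dots> \<le> ((u / x)\<^sup>2) powr 1 * gain_factor \<rho> c u"
    using r assms by (intro mult_right_mono powr_mono gain_factor_bounds) auto
  also have "\<dots> = gain_factor \<rho> c u * (u / x)\<^sup>2" using r by simp
  finally show "gain_factor \<rho> c x \<le> gain_factor \<rho> c u * (u / x)\<^sup>2" .
qed

section \<open>Asymptotic equivalence and its propagation along the chain\<close>

text \<open>For positive \<open>H\<close> this says \<open>ln f - ln H = O(1 / sqrt v)\<close>. The
  multiplicative form passes through products and integrals.\<close>

definition sqrt_equivalent :: "(real \<Rightarrow> real) \<Rightarrow> (real \<Rightarrow> real) \<Rightarrow> bool" where
  "sqrt_equivalent f H \<longleftrightarrow> (\<exists>K>0. \<exists>V\<ge>1. \<forall>v\<ge>V.
     H v * exp (- (K / sqrt v)) \<le> f v \<and> f v \<le> H v * exp (K / sqrt v))"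

lemma sqrt_equivalent_mult_left:
  assumes "sqrt_equivalent f H" "\<And>u. 0 \<le> w u"
  shows "sqrt_equivalent (\<lambda>u. w u * f u) (\<lambda>u. w u * H u)"
proof -
  obtain K V where "K > 0" "V \<ge> 1" "\<And>v. v \<ge> V \<Longrightarrow>
      H v * exp (- (K / sqrt v)) \<le> f v \<and> f v \<le> H v * exp (K / sqrt v)"
    using assms(1) by (auto simp: sqrt_equivalent_def)
  then show ?thesis
    unfolding sqrt_equivalent_def using assms(2)
    by (intro exI[of _ K] conjI exI[of _ V]) (auto simp: mult.assoc intro!: mult_left_mono)
qed

text \<open>Within \<open>sqrt v\<close> of \<open>\<alpha> * v\<close>, \<open>f\<close> equals
  \<open>H (\<alpha> * v)\<close> up to the allowed factor. Outside, \<open>f \<le> 1\<close> and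
  the mass is at most \<open>C / v ^ Suc m\<close>, one power smaller than the slowest-case bound
  \<open>v ^ m\<close> on \<open>1 / H (\<alpha> * v)\<close> can offset.\<close>

lemma sqrt_equivalent_fading_average:
  assumes \<alpha>: "0 < \<alpha>" "\<alpha> < 1" and [measurable]: "f \<in> borel_measurable borel"
    and f: "\<And>u. 0 \<le> f u" "\<And>u. f u \<le> 1"
    and H: "polynomially_decaying m H" and fH: "sqrt_equivalent f H"
  shows "sqrt_equivalent (\<lambda>v. LINT u|lborel. fading_kernel \<alpha> u v * f u) (\<lambda>v. H (\<alpha> * v))"
proof -
  obtain K V where K: "K > 0" and V: "V \<ge> 1" and KV: "\<And>v. v \<ge> V \<Longrightarrow>
      H v * exp (- (K / sqrt v)) \<le> f v \<and> f v \<le> H v * exp (K / sqrt v)"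
    using fH by (auto simp: sqrt_equivalent_def)
  obtain C where C: "C > 0" "\<And>v. v \<ge> 1 \<Longrightarrow>
      (\<integral>\<^sup>+u. ennreal (fading_kernel \<alpha> u v * indicator {u. \<bar>u - \<alpha> * v\<bar> > sqrt v} u) \<partial>lborel)
        \<le> ennreal (C / v ^ Suc m)"
    using fading_kernel_tail_power[OF \<alpha>] by blast
  have H1: "H 1 > 0" using H by (simp add: polynomially_decaying_def)
  \<comment> \<open>The first summand of \<open>K'\<close> pays for moving \<open>H\<close> from
    \<open>u\<close> to \<open>\<alpha> * v\<close>, the second for replacing \<open>sqrt u\<close>
    by \<open>sqrt (\<alpha> * v / 2)\<close>. \<open>D\<close> measures the tail relative to
    \<open>H (\<alpha> * v)\<close>.\<close>
  define K' where "K' = 2 * real m / \<alpha> + K * sqrt (2 / \<alpha>)"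
  define D where "D = C * \<alpha> ^ m / H 1"
  have K': "K' > 0" using K \<alpha> by (simp add: K'_def add_nonneg_pos)
  have D: "D > 0" using C H1 \<alpha> by (simp add: D_def)
  \<comment> \<open>\<open>4 / \<alpha>\<^sup>2\<close> ensures \<open>t \<le> 1 / 2\<close>,
    \<open>2 * V / \<alpha>\<close> keeps the window above \<open>V\<close>, and
    \<open>4 * C\<^sup>2\<close> makes \<open>C / sqrt v \<le> 1 / 2\<close>.\<close>
  define V' where "V' = Max {1, 4 / \<alpha>\<^sup>2, 2 * V / \<alpha>, 4 * C\<^sup>2}"
  have "H (\<alpha> * v) * exp (- ((K' + D + 2 * C) / sqrt v)) \<le> (LINT u|lborel. fading_kernel \<alpha> u v * f u) \<and>
      (LINT u|lborel. fading_kernel \<alpha> u v * f u) \<le> H (\<alpha> * v) * exp ((K' + D + 2 * C) / sqrt v)"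
    if "v \<ge> V'" for v
  proof -
    have v: "v \<ge> 1" "v \<ge> 4 / \<alpha>\<^sup>2" "v \<ge> 2 * V / \<alpha>" "v \<ge> 4 * C\<^sup>2"
      using that by (auto simp: V'_def)
    have sv: "sqrt v \<ge> 1" "sqrt v * sqrt v = v" using v by auto
    have sv_le: "sqrt v \<le> v" using mult_left_mono[OF sv(1), of "sqrt v"] sv by simp
    have x1: "\<alpha> * v / 2 \<ge> V" using v(3) \<alpha> by (simp add: field_simps)
    then have x: "\<alpha> * v \<ge> 1" using V by linarith
    have Hx: "H (\<alpha> * v) > 0" using H x by (auto simp: polynomially_decaying_def)
    \<comment> \<open>The half-width \<open>sqrt v\<close> of the window relative to its centre
      \<open>\<alpha> * v\<close>.\<close>
    define t where "t = 1 / (\<alpha> * sqrt v)"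
    have "2 / \<alpha> \<le> sqrt v"
      using v(2) \<alpha> by (intro real_le_rsqrt) (simp add: power_divide)
    then have t: "0 \<le> t" "t \<le> 1 / 2" using \<alpha> sv by (auto simp: t_def field_simps)
    have xt: "\<alpha> * v * t = sqrt v" using \<alpha> sv by (simp add: t_def field_simps)
    have near: "H (\<alpha> * v) * exp (- (K' / sqrt v)) \<le> f u \<and> f u \<le> H (\<alpha> * v) * exp (K' / sqrt v)"
      if u: "\<bar>u - \<alpha> * v\<bar> \<le> sqrt v" for u
    proof -
      have r: "\<alpha> * v * (1 - t) \<le> u" "u \<le> \<alpha> * v * (1 + t)"
        using u xt by (auto simp: algebra_simps abs_le_iff)
      have "\<alpha> * v * (1 / 2) \<le> \<alpha> * v * (1 - t)" using t x by (intro mult_left_mono) auto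
      then have uu: "\<alpha> * v / 2 \<le> u" using r by simp
      then have "sqrt (\<alpha> * v / 2) \<le> sqrt u" by simp
      then have "K / sqrt u \<le> K / sqrt (\<alpha> * v / 2)"
        using K x x1 V uu by (intro divide_left_mono) auto
      also have "\<dots> = K * sqrt (2 / \<alpha>) / sqrt v"
        using \<alpha> v by (simp add: real_sqrt_mult real_sqrt_divide field_simps)
      finally have Ku: "K / sqrt u + 2 * real m * t \<le> K' / sqrt v"
        by (simp add: K'_def t_def add_divide_distrib)
      have Vu: "u \<ge> V" using uu x1 by linarith
      note n = polynomially_decaying_near[OF H _ t r]
      have "f u \<le> H u * exp (K / sqrt u)" using KV[OF Vu] by simp
      also have "\<dots> \<le> H (\<alpha> * v) * exp (2 * real m * t) * exp (K / sqrt u)"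
        using n x by (intro mult_right_mono) auto
      also have "\<dots> = H (\<alpha> * v) * exp (K / sqrt u + 2 * real m * t)" by (simp add: exp_add)
      also have "\<dots> \<le> H (\<alpha> * v) * exp (K' / sqrt v)" using Ku Hx by simp
      finally have up: "f u \<le> H (\<alpha> * v) * exp (K' / sqrt v)" .
      have "H (\<alpha> * v) * exp (- (K' / sqrt v)) \<le> H (\<alpha> * v) * exp (- (K / sqrt u + 2 * real m * t))"
        using Ku Hx by simp
      also have "\<dots> = H (\<alpha> * v) * exp (- (2 * real m * t)) * exp (- (K / sqrt u))"
        by (simp flip: exp_add)
      also have "\<dots> \<le> H u * exp (- (K / sqrt u))"
        using n x by (intro mult_right_mono) auto
      also have "\<dots> \<le> f u" using KV[OF Vu] by simp
      finally show ?thesis using up by simp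
    qed
    note q = fading_kernel_nonneg[OF \<alpha>]
    define F where "F = (LINT u|lborel. fading_kernel \<alpha> u v * f u)"
    note F = fading_average[OF \<alpha> assms(3) f, of v, folded F_def]
    define \<tau> :: "real \<Rightarrow> real" where "\<tau> = indicator {u. \<bar>u - \<alpha> * v\<bar> > sqrt v}"
    have [measurable]: "\<tau> \<in> borel_measurable borel" unfolding \<tau>_def by measurable
    have \<tau>: "\<tau> u \<ge> 0" for u by (simp add: \<tau>_def)
    have int_c: "(\<integral>\<^sup>+u. ennreal (fading_kernel \<alpha> u v * c) \<partial>lborel) = ennreal c" if "c \<ge> 0" for c
      using that q by (simp add: ennreal_mult nn_integral_multc nn_integral_fading_kernel[OF \<alpha>])
    have tail: "(\<integral>\<^sup>+u. ennreal (fading_kernel \<alpha> u v * \<tau> u) \<partial>lborel) \<le> ennreal (C / v ^ Suc m)"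
      using C(2)[OF v(1)] by (simp add: \<tau>_def)
    \<comment> \<open>Polynomial decay from 1 to \<open>\<alpha> * v\<close> gives
      \<open>H 1 \<le> H (\<alpha> * v) * (\<alpha> * v) ^ m\<close>; the spare power of
      \<open>v\<close> then yields \<open>1 / sqrt v\<close>.\<close>
    have CD: "C / v ^ Suc m \<le> H (\<alpha> * v) * (D / sqrt v)"
    proof -
      have "H 1 \<le> H (\<alpha> * v) * (\<alpha> * v / 1) ^ m"
        using H x unfolding polynomially_decaying_def by (metis zero_less_one)
      then have "C * H 1 \<le> C * (H (\<alpha> * v) * (\<alpha> ^ m * v ^ m))"
        using C by (intro mult_left_mono) (auto simp: power_mult_distrib)
      then have "C / v ^ m \<le> H (\<alpha> * v) * D"
        using H1 v by (simp add: D_def field_simps)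
      then have "C / v ^ m / v \<le> H (\<alpha> * v) * D / v" using v by (intro divide_right_mono) auto
      also have "\<dots> \<le> H (\<alpha> * v) * D / sqrt v"
        using Hx D sv v by (intro divide_left_mono) (auto simp: sv_le)
      finally show ?thesis by (simp add: field_simps)
    qed
    have Cs: "C / v ^ Suc m \<le> C / sqrt v"
    proof -
      have "sqrt v \<le> v ^ 1" using sv_le by simp
      also have "\<dots> \<le> v ^ Suc m" using v by (intro power_increasing) auto
      finally show ?thesis using C v by (intro divide_left_mono) auto
    qed
    define cu where "cu = H (\<alpha> * v) * exp (K' / sqrt v)"
    define cl where "cl = H (\<alpha> * v) * exp (- (K' / sqrt v))"
    have c0: "cu \<ge> 0" "cl \<ge> 0" using Hx by (auto simp: cu_def cl_def)
    \<comment> \<open>Upper bound: \<open>f \<le> cu\<close> inside the window and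
      \<open>f \<le> 1\<close> outside give \<open>f \<le> cu + \<tau>\<close>.\<close>
    have "ennreal F \<le> (\<integral>\<^sup>+u. ennreal (fading_kernel \<alpha> u v * cu) + ennreal (fading_kernel \<alpha> u v * \<tau> u) \<partial>lborel)"
      unfolding F(1)
    proof (intro nn_integral_mono)
      fix u
      have "f u \<le> cu + \<tau> u"
        using near[of u] f(2)[of u] c0 by (cases "\<bar>u - \<alpha> * v\<bar> \<le> sqrt v") (auto simp: cu_def \<tau>_def)
      from mult_left_mono[OF this q]
      show "ennreal (fading_kernel \<alpha> u v * f u) \<le>
          ennreal (fading_kernel \<alpha> u v * cu) + ennreal (fading_kernel \<alpha> u v * \<tau> u)"
        using q \<tau> c0 by (auto simp: distrib_left simp flip: ennreal_plus intro!: ennreal_leI)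
    qed
    also have "\<dots> \<le> ennreal cu + ennreal (C / v ^ Suc m)"
      using tail by (subst nn_integral_add) (auto simp: int_c c0)
    finally have "F \<le> cu + C / v ^ Suc m"
      using c0 C v by (simp flip: ennreal_plus del: power_Suc)
    also have "\<dots> \<le> H (\<alpha> * v) * (exp (K' / sqrt v) + D / sqrt v)"
      using CD by (simp add: cu_def distrib_left del: power_Suc)
    also have "\<dots> \<le> H (\<alpha> * v) * exp ((K' + D + 2 * C) / sqrt v)"
    proof (intro mult_left_mono)
      have a: "1 \<le> exp (K' / sqrt v)" using K' v by simp
      have "exp (K' / sqrt v) + D / sqrt v \<le> exp (K' / sqrt v) + exp (K' / sqrt v) * (D / sqrt v)"
        using mult_right_mono[OF a, of "D / sqrt v"] D v by simp
      also have "\<dots> = exp (K' / sqrt v) * (1 + D / sqrt v)" by (simp add: distrib_left)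
      also have "\<dots> \<le> exp (K' / sqrt v) * exp (D / sqrt v)" by (intro mult_left_mono) auto
      also have "\<dots> = exp ((K' + D) / sqrt v)" by (simp add: add_divide_distrib exp_add)
      also have "\<dots> \<le> exp ((K' + D + 2 * C) / sqrt v)" using C v by (simp add: divide_right_mono)
      finally show "exp (K' / sqrt v) + D / sqrt v \<le> exp ((K' + D + 2 * C) / sqrt v)" .
    qed (use Hx in simp)
    finally have upper: "F \<le> H (\<alpha> * v) * exp ((K' + D + 2 * C) / sqrt v)" .
    \<comment> \<open>Lower bound: the constant \<open>cl\<close> is its own average. The mass lost
      outside the window is added on the right, which avoids subtraction in
      \<open>ennreal\<close>.\<close>
    have "ennreal cl = (\<integral>\<^sup>+u. ennreal (fading_kernel \<alpha> u v * cl) \<partial>lborel)"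
      using int_c c0 by simp
    also have "\<dots> \<le> (\<integral>\<^sup>+u. ennreal (fading_kernel \<alpha> u v * f u) + ennreal cl * ennreal (fading_kernel \<alpha> u v * \<tau> u) \<partial>lborel)"
    proof (intro nn_integral_mono)
      fix u
      have "cl \<le> f u + cl * \<tau> u"
        using near[of u] f(1)[of u] c0 by (cases "\<bar>u - \<alpha> * v\<bar> \<le> sqrt v") (auto simp: cl_def \<tau>_def)
      from mult_left_mono[OF this q]
      show "ennreal (fading_kernel \<alpha> u v * cl) \<le>
          ennreal (fading_kernel \<alpha> u v * f u) + ennreal cl * ennreal (fading_kernel \<alpha> u v * \<tau> u)"
        using q \<tau> c0 f by (auto simp: distrib_left mult_ac simp flip: ennreal_plus ennreal_mult intro!: ennreal_leI)
    qed
    also have "\<dots> \<le> ennreal F + ennreal cl * ennreal (C / v ^ Suc m)"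
      using tail by (subst nn_integral_add) (auto simp: nn_integral_cmult F(1) intro!: add_left_mono mult_left_mono)
    also have "\<dots> = ennreal (F + cl * (C / v ^ Suc m))"
      using F(2) c0 C v by (simp flip: ennreal_mult ennreal_plus del: power_Suc)
    finally have "cl \<le> F + cl * (C / v ^ Suc m)"
      using F(2) c0 C v by (simp flip: ennreal_plus del: power_Suc)
    then have "cl * (1 - C / v ^ Suc m) \<le> F" by (simp add: algebra_simps del: power_Suc)
    moreover have "exp (- (2 * C / sqrt v)) \<le> 1 - C / v ^ Suc m"
    proof -
      have "2 * C \<le> sqrt v" using v(4) by (intro real_le_rsqrt) (simp add: power_mult_distrib)
      then have "exp (- (2 * (C / sqrt v))) \<le> 1 - C / sqrt v"
        using C sv by (intro exp_minus_double_le) (auto simp: field_simps)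
      then show ?thesis using Cs by simp
    qed
    ultimately have "cl * exp (- (2 * C / sqrt v)) \<le> F"
      using c0 by (meson mult_left_mono order_trans)
    \<comment> \<open>Including \<open>D\<close> weakens the lower bound, so that one constant
      serves both sides.\<close>
    moreover have "H (\<alpha> * v) * exp (- ((K' + D + 2 * C) / sqrt v)) \<le> cl * exp (- (2 * C / sqrt v))"
      using Hx D v by (simp add: cl_def mult.assoc divide_simps flip: exp_add)
    ultimately show ?thesis using upper by (simp add: F_def)
  qed
  moreover have "K' + D + 2 * C > 0" using K' D C by simp
  moreover have "V' \<ge> 1" by (simp add: V'_def)
  ultimately show ?thesis unfolding sqrt_equivalent_def by blast
qed

text \<open>The invariant carries measurability and bounds along because the averaging lemma
  requires them of each iterate.\<close>

lemma fading_iterate_regular: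
  assumes \<alpha>: "0 < \<alpha>" "\<alpha> < 1" and c: "c > 0" and \<rho>: "0 \<le> \<rho>" "\<rho> \<le> 1"
  defines "a N \<equiv> (fading_step \<alpha> (gain_factor \<rho> c) ^^ N) (\<lambda>_. 1)"
  shows "a N \<in> borel_measurable borel \<and> (\<forall>v. 0 \<le> a N v \<and> a N v \<le> 1) \<and>
    sqrt_equivalent (a N) (\<lambda>v. \<Prod>i\<in>{1..N}. gain_factor \<rho> (c * \<alpha> ^ (2 * i)) v)"
proof (induction N)
  case 0
  have "sqrt_equivalent (\<lambda>_. 1) (\<lambda>_. 1)"
    unfolding sqrt_equivalent_def by (intro exI[of _ 1] conjI allI impI) auto
  then show ?case by (simp add: a_def)
next
  case (Suc N)
  note w = gain_factor_bounds[OF c \<rho>(1)]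
  let ?G = "\<lambda>N v. \<Prod>i\<in>{1..N}. gain_factor \<rho> (c * \<alpha> ^ (2 * i)) v"
  \<comment> \<open>The new weight enters as the factor \<open>i = 0\<close>; evaluation at
    \<open>\<alpha> * v\<close> then shifts every index up by one.\<close>
  let ?H = "\<lambda>u. \<Prod>i\<in>{0..N}. gain_factor \<rho> (c * \<alpha> ^ (2 * i)) u"
  have a: "a (Suc N) = fading_step \<alpha> (gain_factor \<rho> c) (a N)" by (simp add: a_def)
  have [measurable]: "a N \<in> borel_measurable borel" using Suc by simp
  have H: "?H u = gain_factor \<rho> c u * ?G N u" for u
    by (simp add: prod.atLeast_Suc_atMost)
  have shift: "?H (\<alpha> * v) = ?G (Suc N) v" for v
  proof -
    have "?H (\<alpha> * v) = (\<Prod>i\<in>{0..N}. gain_factor \<rho> (c * \<alpha> ^ (2 * Suc i)) v)"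
      by (intro prod.cong) (auto simp: gain_factor_def power_mult_distrib power2_eq_square mult_ac)
    also have "\<dots> = ?G (Suc N) v"
      by (simp only: One_nat_def prod.shift_bounds_cl_Suc_ivl)
    finally show ?thesis .
  qed
  have "polynomially_decaying (card {0..N} * 2) ?H"
    using \<alpha> c \<rho> by (intro polynomially_decaying_prod polynomially_decaying_gain_factor) auto
  moreover have "sqrt_equivalent (\<lambda>u. gain_factor \<rho> c u * a N u) ?H"
    unfolding H using Suc w by (intro sqrt_equivalent_mult_left) auto
  ultimately have "sqrt_equivalent (a (Suc N)) (\<lambda>v. ?H (\<alpha> * v))"
    unfolding a fading_step_def using Suc w
    by (intro sqrt_equivalent_fading_average[OF \<alpha>]) (auto intro: mult_le_one)
  then have "sqrt_equivalent (a (Suc N)) (?G (Suc N))" unfolding shift .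
  then show ?case
    unfolding a using Suc w fading_step_bounds[OF \<alpha>, of "gain_factor \<rho> c" "a N"] by auto
qed

section \<open>Logarithm of the expectation and estimate of the remainder\<close>

theorem theorem1:
  fixes P \<alpha> \<rho> :: real and N :: nat
  assumes "P > 0" and "N \<ge> 1" and "0 < \<alpha>" and "\<alpha> < 1" and "0 \<le> \<rho>" and "\<rho> \<le> 1"
  shows "\<exists>g h :: real \<Rightarrow> real.
           g \<in> O[at_top](\<lambda>u0. 1 / sqrt u0) \<and>
           h \<in> O[at_top](\<lambda>u0. exp (- (u0\<^sup>2))) \<and>
           (\<forall>u0>0. error_exponent P N \<alpha> \<rho> u0 =
              1 / real N * (\<Sum>i\<in>{1..N}. \<rho> * ln (1 + P * u0\<^sup>2 * \<alpha> ^ (2 * i) / (1 + \<rho>)))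
              + g u0 - h u0)"
proof -
  define c where "c = P / (1 + \<rho>)"
  have c: "c > 0" using assms by (simp add: c_def)
  define a where "a = (fading_step \<alpha> (gain_factor \<rho> c) ^^ N) (\<lambda>_. 1)"
  define G where "G v = (\<Prod>i\<in>{1..N}. gain_factor \<rho> (c * \<alpha> ^ (2 * i)) v)" for v
  define S where "S v = (\<Sum>i\<in>{1..N}. \<rho> * ln (1 + P * v\<^sup>2 * \<alpha> ^ (2 * i) / (1 + \<rho>)))" for v
  \<comment> \<open>With \<open>g\<close> as the full remainder the identity holds by definition;
    only its size at infinity has to be shown.\<close>
  define g where "g v = error_exponent P N \<alpha> \<rho> v - 1 / real N * S v" for v
  have E: "error_exponent P N \<alpha> \<rho> v = - (1 / real N) * ln (a v)" for v
    using integral_fading_law[OF assms(3,4), of "gain_factor \<rho> c" N v] gain_factor_bounds[OF c assms(5)]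
    by (simp add: error_exponent_def a_def c_def gain_factor_def)
  have pos: "1 + c * \<alpha> ^ (2 * i) * v\<^sup>2 > 0" for i and v :: real
    using c assms by (intro add_pos_nonneg) auto
  have gp: "gain_factor \<rho> (c * \<alpha> ^ (2 * i)) v > 0" for i v
    using pos[of i v] by (simp add: gain_factor_def)
  then have G: "G v > 0" for v unfolding G_def by (intro prod_pos) auto
  have lnG: "ln (G v) = - S v" for v
  proof -
    have "ln (G v) = (\<Sum>i\<in>{1..N}. ln (gain_factor \<rho> (c * \<alpha> ^ (2 * i)) v))"
      unfolding G_def using gp by (intro ln_prod) (auto simp: less_imp_neq[THEN not_sym])
    also have "\<dots> = (\<Sum>i\<in>{1..N}. - (\<rho> * ln (1 + P * v\<^sup>2 * \<alpha> ^ (2 * i) / (1 + \<rho>))))"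
    proof (intro sum.cong refl)
      fix i
      have "1 + P * v\<^sup>2 * \<alpha> ^ (2 * i) / (1 + \<rho>) = 1 + c * \<alpha> ^ (2 * i) * v\<^sup>2"
        by (simp add: c_def)
      then show "ln (gain_factor \<rho> (c * \<alpha> ^ (2 * i)) v) = - (\<rho> * ln (1 + P * v\<^sup>2 * \<alpha> ^ (2 * i) / (1 + \<rho>)))"
        using pos[of i v] by (simp only: gain_factor_def) (simp add: ln_powr ln_div)
    qed
    finally show ?thesis by (simp add: S_def sum_negf)
  qed
  obtain K V where K: "K > 0" and V: "V \<ge> 1" and KV: "\<And>v. v \<ge> V \<Longrightarrow>
      G v * exp (- (K / sqrt v)) \<le> a v \<and> a v \<le> G v * exp (K / sqrt v)"
    using fading_iterate_regular[OF assms(3,4) c assms(5,6), of N]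
    unfolding sqrt_equivalent_def a_def[symmetric] G_def[symmetric] by auto
  have "norm (g v) \<le> K * norm (1 / sqrt v)" if "v \<ge> V" for v
  proof -
    \<comment> \<open>Positivity of \<open>a v\<close> comes from the lower bound and makes
      \<open>ln\<close> monotone here, so the two-sided factor becomes an additive error.\<close>
    have "0 < G v * exp (- (K / sqrt v))" using G by simp
    also have "\<dots> \<le> a v" using KV[OF that] by simp
    finally have av: "a v > 0" .
    have "ln (G v * exp (- (K / sqrt v))) \<le> ln (a v)" "ln (a v) \<le> ln (G v * exp (K / sqrt v))"
      using KV[OF that] G[of v] av by auto
    then have "\<bar>ln (a v) + S v\<bar> \<le> K / sqrt v"
      using G[of v] lnG[of v] by (simp add: ln_mult abs_le_iff)
    moreover have "g v = - (1 / real N) * (ln (a v) + S v)"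
      by (simp add: g_def E algebra_simps)
    then have "\<bar>g v\<bar> = \<bar>ln (a v) + S v\<bar> / real N" by (simp add: abs_mult)
    \<comment> \<open>Since \<open>N \<ge> 1\<close>, dividing by \<open>N\<close> cannot enlarge
      the error, so \<open>K\<close> itself serves as the constant.\<close>
    moreover have "\<bar>ln (a v) + S v\<bar> / real N \<le> \<bar>ln (a v) + S v\<bar> / 1"
      using assms(2) by (intro divide_left_mono) auto
    ultimately show ?thesis using that V by simp
  qed
  then have "g \<in> O[at_top](\<lambda>u0. 1 / sqrt u0)"
    by (intro bigoI[of _ K] eventually_at_top_linorderI[of V])
  then show ?thesis
    by (intro exI[of _ g] exI[of _ "\<lambda>_. 0"]) (simp add: g_def S_def)
qed

end
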